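(* Let $g_q(t\mid\zeta)=\frac{\zeta q e^{t}+1}{[2]_q}$ and $g_q'(t\mid\zeta)=\frac{d}{dt}g_q(t\mid\zeta)$. Then for all $n\ge 0$, $$E_{n+1,\zeta}^q(x)=\left(x-\frac{g_q'(t\mid\zeta)}{g_q(t\mid\zeta)}\right)E_{n,\zeta}^q(x).$$ Moreover, $\lambda(-n-1,x:q:\zeta)=\left(x-\frac{g_q'(t\mid\zeta)}{g_q(t\mid\zeta)}\right)\lambda(-n,x:q:\zeta)$.
   Context: Let $p$ be an odd prime, $\mathbb{C}_p$ the completion of an algebraic closure of $\mathbb{Q}_p$, $q\in\mathbb{C}_p$ with $|q-1|_p<1$, $\zeta\in\mathbb{C}_p$ with $|1-\zeta|_p<1$, and $[2]_q=1+q$. The weighted $q$-Euler polynomials $E_{n,\zeta}^q(x)$ are defined by $\frac{[2]_q}{q\zeta e^{t}+1}e^{tx}=\sum_{n\ge0}E_{n,\zeta}^{q}(x)\frac{t^n}{n!}$. The weighted $q$-zeta function $\lambda(s,x:q:\zeta)=[2]_q\sum_{m\ge0}\frac{(-1)^mq^m\zeta^m}{(m+x)^s}$ satisfies, at nonpositive integers, $\lambda(-n,x:q:\zeta)=E_{n,\zeta}^q(x)$ for $n\ge0$. Umbral calculus: a formal power series $h(t)=\sum_k a_k t^k/k!$ acts on polynomials as an operator by $t^k p(x)=p^{(k)}(x)$ (so $e^{yt}p(x)=p(x+y)$); $x$ denotes multiplication by $x$. The quotient $g_q'/g_q$ is a formal power series since $g_q$ is invertible.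
   Formalization: The series defining λ(-n,x:q:ζ) diverges in C_p since |q|=|ζ|=1; here it is summed by inserting T^m, reading the result as a rational function of T and evaluating at T=1, which gives the stated values λ(-n,x:q:ζ)=E_{n,ζ}^q(x). *)

theory Defs
  imports Complex_Main "HOL-Computational_Algebra.Computational_Algebra"
begin

section \<open>The field of p-adic complex numbers\<close>

definition nrm_tendsto :: "('a::field \<Rightarrow> real) \<Rightarrow> (nat \<Rightarrow> 'a) \<Rightarrow> 'a \<Rightarrow> bool"
  where "nrm_tendsto nrm X l \<longleftrightarrow> (\<lambda>n. nrm (X n - l)) \<longlonglongrightarrow> 0"

definition nrm_Cauchy :: "('a::field \<Rightarrow> real) \<Rightarrow> (nat \<Rightarrow> 'a) \<Rightarrow> bool"
  where "nrm_Cauchy nrm X \<longleftrightarrow> (\<forall>e>0. \<exists>N. \<forall>m\<ge>N. \<forall>n\<ge>N. nrm (X m - X n) < e)"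

definition nrm_closure :: "('a::field \<Rightarrow> real) \<Rightarrow> 'a set \<Rightarrow> 'a set"
  where "nrm_closure nrm S = {x. \<exists>X. (\<forall>n. X n \<in> S) \<and> nrm_tendsto nrm X x}"

definition algebraic_over :: "'a::field set \<Rightarrow> 'a set"
  where "algebraic_over S = {x. \<exists>f. f \<noteq> 0 \<and> (\<forall>i. coeff f i \<in> S) \<and> poly f x = 0}"

text \<open>
  The locale describes the completion of an algebraic closure of the p-adic numbers, with its
  normalised absolute value \<open>nrm\<close>, up to isometric isomorphism. On the prime field,
  \<open>nrm\<close> is the p-adic absolute value by Ostrowski's theorem, so that the closure of
  \<open>\<rat>\<close> in the complete field \<open>'a\<close> is the field of p-adic numbers. The
  elements algebraic over it form an algebraic closure, since \<open>'a\<close> is algebraically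
  closed, and \<open>'a\<close> is the completion of that algebraic closure, by completeness and
  the last assumption.
\<close>

locale padic_complex_field =
  fixes p :: nat and nrm :: "'a :: {field_char_0, alg_closed_field} \<Rightarrow> real"
  assumes prime_p: "prime p"
    and nrm_nonneg: "nrm x \<ge> 0"
    and nrm_eq_0_iff: "nrm x = 0 \<longleftrightarrow> x = 0"
    and nrm_mult: "nrm (x * y) = nrm x * nrm y"
    and nrm_ultrametric: "nrm (x + y) \<le> max (nrm x) (nrm y)"
    and nrm_p: "nrm (of_nat p) = 1 / real p"
    and complete: "nrm_Cauchy nrm X \<Longrightarrow> \<exists>l. nrm_tendsto nrm X l"
    and algebraic_dense: "nrm_closure nrm (algebraic_over (nrm_closure nrm \<rat>)) = UNIV"

section \<open>Weighted q-Euler polynomials\<close>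

definition qbracket2 :: "'a::field_char_0 \<Rightarrow> 'a"
  where "qbracket2 q = 1 + q"

definition fps_lift_poly :: "'a::field_char_0 fps \<Rightarrow> 'a poly fps"
  where "fps_lift_poly F = Abs_fps (\<lambda>n. [:fps_nth F n:])"

text \<open>The series \<open>e\<^sup>t\<^sup>x\<close> in \<open>t\<close>, with coefficients polynomials in \<open>x\<close>.\<close>

definition fps_exp_X :: "'a::field_char_0 poly fps"
  where "fps_exp_X = Abs_fps (\<lambda>n. smult (1 / fact n) ([:0, 1:] ^ n))"

definition euler_gf :: "'a::field_char_0 \<Rightarrow> 'a \<Rightarrow> 'a poly fps"
  where "euler_gf q \<zeta> =
    fps_lift_poly (fps_const (qbracket2 q) / (fps_const (q * \<zeta>) * fps_exp 1 + 1)) * fps_exp_X"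

definition wq_euler_poly :: "'a::field_char_0 \<Rightarrow> 'a \<Rightarrow> nat \<Rightarrow> 'a poly"
  where "wq_euler_poly q \<zeta> n = smult (fact n) (fps_nth (euler_gf q \<zeta>) n)"

section \<open>Umbral calculus\<close>

text \<open>
  Since \<open>fps_nth h k\<close> is already the coefficient \<open>a\<^sub>k / k!\<close>, the operator
  \<open>h(t) = \<Sum>\<^sub>k a\<^sub>k t\<^sup>k / k!\<close> is the sum below; derivatives of order
  greater than the degree vanish.
\<close>

definition umbral_op :: "'a::field_char_0 fps \<Rightarrow> 'a poly \<Rightarrow> 'a poly"
  where "umbral_op h f = (\<Sum>k\<le>degree f. smult (fps_nth h k) ((pderiv ^^ k) f))"

definition g_series :: "'a::field_char_0 \<Rightarrow> 'a \<Rightarrow> 'a fps"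
  where "g_series q \<zeta> = (fps_const (\<zeta> * q) * fps_exp 1 + 1) / fps_const (qbracket2 q)"

definition recurrence_op :: "'a::field_char_0 \<Rightarrow> 'a \<Rightarrow> 'a poly \<Rightarrow> 'a poly"
  where "recurrence_op q \<zeta> f =
    [:0, 1:] * f - umbral_op (fps_deriv (g_series q \<zeta>) / g_series q \<zeta>) f"

section \<open>The weighted q-zeta function\<close>

text \<open>
  For \<open>\<bar>q\<bar> = \<bar>\<zeta>\<bar> = 1\<close> the terms of the series
  \<open>\<Sum>\<^sub>m (-1)\<^sup>m q\<^sup>m \<zeta>\<^sup>m / (m + x)\<^sup>s\<close> do not tend to \<open>0\<close>, so
  it has no p-adic limit. At nonpositive integers \<open>s\<close> it is summed in the usual way: its
  generating series \<open>\<Sum>\<^sub>m a\<^sub>m T\<^sup>m\<close> is the expansion of a rational function of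
  \<open>T\<close> without pole at \<open>T = 1\<close>, and the sum is the value of that function at
  \<open>T = 1\<close>.
\<close>

definition has_rational_sum :: "(nat \<Rightarrow> 'a::field_char_0) \<Rightarrow> 'a \<Rightarrow> bool"
  where "has_rational_sum a s \<longleftrightarrow>
    (\<exists>P Q. poly Q 1 \<noteq> 0 \<and> fps_of_poly Q * Abs_fps a = fps_of_poly P \<and> s = poly P 1 / poly Q 1)"

lemma has_rational_sum_unique:
  assumes "has_rational_sum a s" and "has_rational_sum a s'"
  shows "s = s'"
proof -
  obtain P Q where PQ: "poly Q 1 \<noteq> 0" "fps_of_poly Q * Abs_fps a = fps_of_poly P"
      "s = poly P 1 / poly Q 1"
    using assms(1) unfolding has_rational_sum_def by blast
  obtain P' Q' where PQ': "poly Q' 1 \<noteq> 0" "fps_of_poly Q' * Abs_fps a = fps_of_poly P'"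
      "s' = poly P' 1 / poly Q' 1"
    using assms(2) unfolding has_rational_sum_def by blast
  have "fps_of_poly (P * Q') = fps_of_poly (P' * Q)"
    unfolding fps_of_poly_mult PQ(2)[symmetric] PQ'(2)[symmetric] by (simp add: mult_ac)
  then have "P * Q' = P' * Q"
    by (simp only: fps_of_poly_eq_iff)
  then have "poly P 1 * poly Q' 1 = poly P' 1 * poly Q 1"
    by (metis poly_mult)
  then show ?thesis
    using PQ PQ' by (simp add: frac_eq_eq)
qed

definition rational_sum :: "(nat \<Rightarrow> 'a::field_char_0) \<Rightarrow> 'a"
  where "rational_sum a = (THE s. has_rational_sum a s)"

text \<open>
  With \<open>s = - int n\<close> each summand is \<open>(-1)\<^sup>m q\<^sup>m \<zeta>\<^sup>m (m + x)\<^sup>n\<close>, also when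
  \<open>m + x = 0\<close>. The definition is meaningful only for \<open>s \<le> 0\<close>.
\<close>

definition wq_zeta :: "'a::field_char_0 \<Rightarrow> 'a \<Rightarrow> int \<Rightarrow> 'a \<Rightarrow> 'a"
  where "wq_zeta q \<zeta> s x =
    qbracket2 q * rational_sum (\<lambda>m. (-1) ^ m * q ^ m * \<zeta> ^ m / (of_nat m + x) powi s)"

end

theory Submission
  imports Defs
begin

text \<open>
  Write \<open>G\<close> for the generating function of the Euler polynomials and \<open>F = 1 / g\<close>, so that
  \<open>G = F e\<^sup>t\<^sup>x\<close>. Differentiating \<open>G\<close> in \<open>t\<close> gives \<open>G' = x G - (g' / g) G\<close>.
  Since \<open>d/dx\<close> acts on \<open>G\<close> as multiplication by \<open>t\<close>, a series \<open>h(t)\<close> acts umbrally on the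
  coefficients of \<open>G\<close> by multiplying \<open>G\<close> with \<open>h\<close>, and the recurrence follows by
  comparing coefficients.

  For the zeta values, let \<open>A\<^sub>n(T)\<close> be the series \<open>\<Sum>\<^sub>m (-a)\<^sup>m (m + x)\<^sup>n T\<^sup>m\<close> with
  \<open>a = q \<zeta>\<close>. Splitting off the term \<open>m = 0\<close> gives
  \<open>(1 + a T) A\<^sub>n = x\<^sup>n - a T \<Sum>\<^sub>k\<^sub><\<^sub>n (n choose k) A\<^sub>k\<close>, so \<open>A\<^sub>n\<close> is rational, and its value at
  \<open>T = 1\<close> satisfies the recursion that \<open>(q \<zeta> e\<^sup>t + 1) G = (1 + q) e\<^sup>t\<^sup>x\<close> yields
  for the Euler polynomials.
\<close>

lemma fps_lift_poly_nth [simp]: "fps_nth (fps_lift_poly F) n = [:fps_nth F n:]"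
  by (simp add: fps_lift_poly_def)

lemma fps_lift_poly_add: "fps_lift_poly (F + G) = fps_lift_poly F + fps_lift_poly G"
  by (rule fps_ext) simp

lemma fps_lift_poly_uminus: "fps_lift_poly (- F) = - fps_lift_poly F"
  by (rule fps_ext) simp

lemma pCons_sum_const: "[:\<Sum>i\<in>A. f i:] = (\<Sum>i\<in>A. [:f i:])"
  by (rule poly_eqI) (auto simp: coeff_sum coeff_pCons split: nat.split)

lemma fps_lift_poly_mult: "fps_lift_poly (F * G) = fps_lift_poly F * fps_lift_poly G"
  by (rule fps_ext) (simp add: fps_mult_nth pCons_sum_const mult.commute)

lemma fps_deriv_lift_poly: "fps_deriv (fps_lift_poly F) = fps_lift_poly (fps_deriv F)"
  by (rule fps_ext) (simp add: of_nat_poly)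

lemma fps_exp_X_nth [simp]: "fps_nth fps_exp_X n = smult (1 / fact n) ([:0, 1:] ^ n)"
  by (simp add: fps_exp_X_def)

lemma fps_deriv_exp_X: "fps_deriv fps_exp_X = fps_const [:0, 1 :: 'a::field_char_0:] * fps_exp_X"
proof (rule fps_ext)
  fix n
  have "(1 + of_nat n) * (1 / ((1 + of_nat n) * fact n)) = (1 / fact n :: 'a)"
    by (metis nonzero_mult_divide_mult_cancel_left mult.right_neutral of_nat_Suc of_nat_neq_0
        times_divide_eq_right)
  then show "fps_nth (fps_deriv fps_exp_X) n
      = fps_nth (fps_const [:0, 1 :: 'a:] * fps_exp_X) n"
    by (simp add: of_nat_poly del: of_nat_Suc)
qed

lemma pderiv_X_power: "pderiv ([:0, 1 :: 'a::field_char_0:] ^ Suc n) = smult (of_nat (Suc n)) ([:0, 1:] ^ n)"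
  unfolding pderiv_power_Suc by (simp add: pderiv_pCons)

lemma pderiv_exp_X_nth_Suc:
  "pderiv (fps_nth fps_exp_X (Suc n)) = (fps_nth fps_exp_X n :: 'a::field_char_0 poly)"
  by (simp add: pderiv_smult pderiv_X_power del: power_Suc of_nat_Suc)

lemma pderiv_lift_exp_X_nth_0:
  "pderiv (fps_nth (fps_lift_poly F * fps_exp_X) 0) = 0"
  by (simp add: pderiv_smult)

lemma pderiv_lift_exp_X_nth_Suc:
  "pderiv (fps_nth (fps_lift_poly F * fps_exp_X) (Suc n)) = fps_nth (fps_lift_poly F * fps_exp_X) n"
proof -
  have "pderiv (fps_nth (fps_lift_poly F * fps_exp_X) (Suc n))
      = (\<Sum>i\<le>Suc n. smult (fps_nth F i) (pderiv (fps_nth fps_exp_X (Suc n - i))))"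
    by (simp only: fps_mult_nth atLeast0AtMost fps_lift_poly_nth
        higher_pderiv_sum[of 1, unfolded One_nat_def funpow.simps o_id])
       (simp add: pderiv_smult)
  also have "\<dots> = (\<Sum>i\<le>n. smult (fps_nth F i) (pderiv (fps_nth fps_exp_X (Suc n - i))))"
    by (simp add: pderiv_smult)
  also have "\<dots> = (\<Sum>i\<le>n. smult (fps_nth F i) (fps_nth fps_exp_X (n - i)))"
    by (rule sum.cong) (simp_all only: Suc_diff_le pderiv_exp_X_nth_Suc atMost_iff)
  finally show ?thesis
    by (simp add: fps_mult_nth atLeast0AtMost)
qed

lemma higher_pderiv_lift_exp_X_nth:
  "(pderiv ^^ k) (fps_nth (fps_lift_poly F * fps_exp_X) n) =
    (if k \<le> n then fps_nth (fps_lift_poly F * fps_exp_X) (n - k) else 0)"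
proof (induction k)
  case (Suc k)
  show ?case
  proof (cases "k < n")
    case True
    then have "n - k = Suc (n - Suc k)" by simp
    then show ?thesis using Suc True by (simp add: pderiv_lift_exp_X_nth_Suc del: fps_mult_nth_0)
  next
    case False
    then show ?thesis using Suc by (auto simp: pderiv_lift_exp_X_nth_0 simp del: fps_mult_nth_0)
  qed
qed simp

lemma umbral_op_eq_sum:
  assumes "degree f \<le> n"
  shows "umbral_op h f = (\<Sum>k\<le>n. smult (fps_nth h k) ((pderiv ^^ k) f))"
  unfolding umbral_op_def
proof (rule sum.mono_neutral_left)
  show "\<forall>k\<in>{..n} - {..degree f}. smult (fps_nth h k) ((pderiv ^^ k) f) = 0"
    by (auto simp: poly_eq_iff coeff_higher_pderiv coeff_eq_0)
qed (use assms in auto)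

lemma umbral_op_smult: "umbral_op h (smult c f) = smult c (umbral_op h f)"
proof -
  have "umbral_op h (smult c f)
      = (\<Sum>k\<le>degree f. smult (fps_nth h k) ((pderiv ^^ k) (smult c f)))"
    by (rule umbral_op_eq_sum) (rule degree_smult_le)
  then show ?thesis
    by (auto simp: umbral_op_def higher_pderiv_smult poly_eq_iff coeff_sum sum_distrib_left mult_ac)
qed

lemma degree_lift_exp_X_nth: "degree (fps_nth (fps_lift_poly F * fps_exp_X) n) \<le> n"
  unfolding fps_mult_nth
proof (rule degree_sum_le)
  fix i assume "i \<in> {0..n}"
  have "degree (fps_nth (fps_lift_poly F) i * fps_nth fps_exp_X (n - i)) \<le> n - i"
    by (auto simp: degree_power_eq)
  then show "degree (fps_nth (fps_lift_poly F) i * fps_nth fps_exp_X (n - i)) \<le> n"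
    by simp
qed simp

lemma umbral_op_lift_exp_X_nth:
  "umbral_op h (fps_nth (fps_lift_poly F * fps_exp_X) n) =
    fps_nth (fps_lift_poly h * (fps_lift_poly F * fps_exp_X)) n"
  unfolding umbral_op_eq_sum[OF degree_lift_exp_X_nth] higher_pderiv_lift_exp_X_nth
  by (simp add: fps_mult_nth[of "fps_lift_poly h"] atLeast0AtMost)

lemma wq_euler_poly_Suc:
  fixes q \<zeta> :: "'a::field_char_0"
  assumes "1 + q \<noteq> 0" and "1 + q * \<zeta> \<noteq> 0"
  shows "wq_euler_poly q \<zeta> (Suc n) = recurrence_op q \<zeta> (wq_euler_poly q \<zeta> n)"
proof -
  define D where "D = fps_const (q * \<zeta>) * fps_exp 1 + 1"
  define F where "F = fps_const (qbracket2 q) / D"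
  define g where "g = g_series q \<zeta>"
  define h where "h = fps_deriv g / g"
  have D0: "fps_nth D 0 \<noteq> 0" using assms(2) by (simp add: D_def add.commute)
  have b: "qbracket2 q \<noteq> 0" using assms(1) by (simp add: qbracket2_def)
  have g: "g = D * fps_const (inverse (qbracket2 q))"
    using b by (simp add: g_def g_series_def D_def mult.commute fps_divide_unit fps_const_inverse)
  have g0: "fps_nth g 0 \<noteq> 0" using D0 b by (simp add: g)
  have "F * g = (fps_const (qbracket2 q) * fps_const (inverse (qbracket2 q))) * (inverse D * D)"
    by (simp only: F_def g fps_divide_unit[OF D0] ac_simps)
  also have "\<dots> = 1" using D0 b by (simp add: inverse_mult_eq_1)
  finally have Fg: "F * g = 1" .
  have hg: "h * g = fps_deriv g"
    using g0 by (simp add: h_def fps_divide_unit mult.assoc inverse_mult_eq_1)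
  have "g * (fps_deriv F + h * F) = fps_deriv (F * g)"
    by (simp add: hg[symmetric] algebra_simps)
  also have "\<dots> = 0" by (simp add: Fg)
  finally have "fps_deriv F + h * F = 0" using g0 by auto
  then have F': "fps_deriv F = - (h * F)" by (simp add: eq_neg_iff_add_eq_0)
  define G where "G = fps_lift_poly F * fps_exp_X"
  have E: "wq_euler_poly q \<zeta> n = smult (fact n) (fps_nth G n)" for n
    by (simp add: wq_euler_poly_def euler_gf_def G_def F_def D_def)
  have "fps_deriv G = fps_const [:0, 1:] * G - fps_lift_poly h * G"
    by (simp add: G_def fps_deriv_lift_poly F' fps_deriv_exp_X fps_lift_poly_uminus
        fps_lift_poly_mult algebra_simps)
  then have "fps_nth (fps_deriv G) n
      = [:0, 1:] * fps_nth G n - umbral_op h (fps_nth G n)"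
    by (simp add: G_def umbral_op_lift_exp_X_nth del: mult_pCons_left)
  moreover have "fps_nth (fps_deriv G) n = smult (of_nat (Suc n)) (fps_nth G (Suc n))"
    by (simp add: of_nat_poly del: of_nat_Suc)
  ultimately show ?thesis
    unfolding E recurrence_op_def g_def[symmetric] h_def[symmetric] umbral_op_smult
    by (metis fact_Suc mult.commute mult_smult_right of_nat_fact of_nat_mult smult_diff_right
        smult_smult)
qed

lemma wq_euler_poly_sum_binomial:
  fixes q \<zeta> :: "'a::field_char_0"
  assumes "1 + q * \<zeta> \<noteq> 0"
  shows "q * \<zeta> * (\<Sum>k\<le>n. of_nat (n choose k) * poly (wq_euler_poly q \<zeta> k) x)
    + poly (wq_euler_poly q \<zeta> n) x = (1 + q) * x ^ n"
proof -
  define D where "D = fps_const (q * \<zeta>) * fps_exp 1 + 1"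
  define F where "F = fps_const (qbracket2 q) / D"
  have D0: "fps_nth D 0 \<noteq> 0" using assms by (simp add: D_def add.commute)
  define G where "G = fps_lift_poly F * fps_exp_X"
  have E: "poly (wq_euler_poly q \<zeta> n) x = fact n * poly (fps_nth G n) x" for n
    by (simp add: wq_euler_poly_def euler_gf_def G_def F_def D_def)
  have "D * F = fps_const (qbracket2 q)"
    using D0 by (simp add: F_def fps_divide_unit mult.left_commute inverse_mult_eq_1')
  then have "fps_lift_poly D * G = fps_lift_poly (fps_const (qbracket2 q)) * fps_exp_X"
    by (simp add: G_def fps_lift_poly_mult[symmetric] mult.assoc[symmetric])
  moreover have "fps_lift_poly (fps_const c) = fps_const [:c:]" for c :: 'a
    by (rule fps_ext) simp
  moreover have "fps_lift_poly 1 = (1 :: 'a poly fps)"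
    by (rule fps_ext) simp
  ultimately have "fps_const [:q * \<zeta>:] * (G * fps_lift_poly (fps_exp 1)) + G
      = fps_const [:qbracket2 q:] * fps_exp_X"
    by (simp add: D_def fps_lift_poly_add fps_lift_poly_mult algebra_simps)
  then have "fact n * poly (fps_nth (fps_const [:q * \<zeta>:] * (G * fps_lift_poly (fps_exp 1)) + G) n) x
      = fact n * poly (fps_nth (fps_const [:qbracket2 q:] * fps_exp_X) n) x"
    by simp
  then have "q * \<zeta> * (fact n * (\<Sum>k\<le>n. poly (fps_nth G k) x / fact (n - k)))
      + fact n * poly (fps_nth G n) x = (1 + q) * x ^ n"
    by (simp add: fps_mult_nth[of G] poly_sum atLeast0AtMost qbracket2_def distrib_left
        sum_distrib_left mult.assoc mult.left_commute[of "fact n"])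
      (simp flip: add_divide_distrib)
  moreover have "fact n * (\<Sum>k\<le>n. poly (fps_nth G k) x / fact (n - k))
      = (\<Sum>k\<le>n. of_nat (n choose k) * poly (wq_euler_poly q \<zeta> k) x)"
    unfolding sum_distrib_left
    by (rule sum.cong) (simp_all add: E binomial_fact)
  ultimately show ?thesis by (simp only: E)
qed

lemma rational_sum_eq: "has_rational_sum a s \<Longrightarrow> rational_sum a = s"
  unfolding rational_sum_def using has_rational_sum_unique by blast

lemma has_rational_sum_of_poly: "has_rational_sum (fps_nth (fps_of_poly P)) (poly P 1)"
  unfolding has_rational_sum_def
  by (rule exI[of _ P], rule exI[of _ 1]) (simp add: fps_nth_inverse)

lemma has_rational_sum_add:
  assumes "has_rational_sum (fps_nth A) s" and "has_rational_sum (fps_nth B) t"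
  shows "has_rational_sum (fps_nth (A + B)) (s + t)"
proof -
  obtain P Q where 1: "poly Q 1 \<noteq> 0" "fps_of_poly Q * A = fps_of_poly P" "s = poly P 1 / poly Q 1"
    using assms(1) by (auto simp: has_rational_sum_def fps_nth_inverse)
  obtain P' Q' where 2: "poly Q' 1 \<noteq> 0" "fps_of_poly Q' * B = fps_of_poly P'"
      "t = poly P' 1 / poly Q' 1"
    using assms(2) by (auto simp: has_rational_sum_def fps_nth_inverse)
  have "fps_of_poly (Q * Q') * (A + B) = fps_of_poly (P * Q' + P' * Q)"
    by (simp add: fps_of_poly_mult fps_of_poly_add 1(2)[symmetric] 2(2)[symmetric] algebra_simps)
  then show ?thesis
    unfolding has_rational_sum_def using 1 2
    by (intro exI[of _ "P * Q' + P' * Q"] exI[of _ "Q * Q'"])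
       (simp add: fps_nth_inverse add_frac_eq)
qed

lemma has_rational_sum_mult_poly:
  assumes "has_rational_sum (fps_nth A) s"
  shows "has_rational_sum (fps_nth (fps_of_poly R * A)) (poly R 1 * s)"
proof -
  obtain P Q where 1: "poly Q 1 \<noteq> 0" "fps_of_poly Q * A = fps_of_poly P" "s = poly P 1 / poly Q 1"
    using assms(1) by (auto simp: has_rational_sum_def fps_nth_inverse)
  have "fps_of_poly Q * (fps_of_poly R * A) = fps_of_poly (R * P)"
    by (simp add: fps_of_poly_mult 1(2)[symmetric] mult.left_commute)
  then show ?thesis
    unfolding has_rational_sum_def using 1
    by (intro exI[of _ "R * P"] exI[of _ Q]) (simp add: fps_nth_inverse)
qed

lemma has_rational_sum_divide_poly:
  assumes "has_rational_sum (fps_nth (fps_of_poly R * A)) (poly R 1 * s)" and "poly R 1 \<noteq> 0"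
  shows "has_rational_sum (fps_nth A) s"
proof -
  obtain P Q where 1: "poly Q 1 \<noteq> 0" "fps_of_poly Q * (fps_of_poly R * A) = fps_of_poly P"
      "poly R 1 * s = poly P 1 / poly Q 1"
    using assms(1) by (auto simp: has_rational_sum_def fps_nth_inverse)
  have "fps_of_poly (Q * R) * A = fps_of_poly P"
    by (simp add: fps_of_poly_mult 1(2)[symmetric] mult.assoc)
  then show ?thesis
    unfolding has_rational_sum_def using 1 assms(2)
    by (intro exI[of _ P] exI[of _ "Q * R"]) (simp add: fps_nth_inverse field_simps)
qed

lemma has_rational_sum_sum:
  assumes "finite I" and "\<And>i. i \<in> I \<Longrightarrow> has_rational_sum (fps_nth (A i)) (s i)"
  shows "has_rational_sum (fps_nth (\<Sum>i\<in>I. A i)) (\<Sum>i\<in>I. s i)"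
  using assms
proof (induction rule: finite_induct)
  case empty
  show ?case using has_rational_sum_of_poly[of 0] by (simp only: fps_of_poly_0 sum.empty poly_0)
next
  case (insert i I)
  then show ?case
    using has_rational_sum_add[of "A i" "s i" "sum A I" "sum s I"] by (simp del: fps_add_nth)
qed

lemma power_series_shift_expansion:
  fixes a x :: "'a::field_char_0"
  defines "A \<equiv> \<lambda>n. Abs_fps (\<lambda>m. (- a) ^ m * (of_nat m + x) ^ n)"
  shows "fps_of_poly [:1, a:] * A n =
    fps_of_poly [:x ^ n:] + (\<Sum>k<n. fps_of_poly [:0, - a * of_nat (n choose k):] * A k)"
proof -
  have split: "A n = fps_const (x ^ n) - fps_const a * fps_X * (\<Sum>k\<le>n. fps_const (of_nat (n choose k)) * A k)"
  proof (rule fps_ext)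
    fix m
    show "fps_nth (A n) m = fps_nth (fps_const (x ^ n)
      - fps_const a * fps_X * (\<Sum>k\<le>n. fps_const (of_nat (n choose k)) * A k)) m"
    proof (cases m)
      case (Suc j)
      have "(of_nat m + x) ^ n = (\<Sum>k\<le>n. of_nat (n choose k) * (of_nat j + x) ^ k)"
        using binomial_ring[of "of_nat j + x" 1 n] Suc by (simp add: add_ac)
      then show ?thesis
        by (simp add: A_def Suc mult.assoc fps_sum_nth sum_distrib_left mult.left_commute sum_negf)
    qed (simp add: A_def mult.assoc)
  qed
  have last: "(\<Sum>k\<le>n. fps_const (of_nat (n choose k)) * A k)
      = (\<Sum>k<n. fps_const (of_nat (n choose k)) * A k) + A n"
    by (simp flip: lessThan_Suc_atMost)
  have lin: "fps_of_poly [:0, c:] = fps_const c * fps_X" for c :: 'a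
    by (simp add: fps_of_poly_pCons)
  have "(\<Sum>k<n. fps_of_poly [:0, - a * of_nat (n choose k):] * A k)
      = - (fps_const a * fps_X * (\<Sum>k<n. fps_const (of_nat (n choose k)) * A k))"
    unfolding sum_distrib_left sum_negf[symmetric] lin
    by (rule sum.cong) (simp_all flip: fps_const_mult fps_const_neg add: mult_ac)
  moreover have "fps_of_poly [:1, a:] * A n = A n + fps_const a * fps_X * A n"
    by (simp add: fps_of_poly_pCons distrib_right)
  moreover have "A n + fps_const a * fps_X * A n
      = fps_const (x ^ n) - fps_const a * fps_X * (\<Sum>k<n. fps_const (of_nat (n choose k)) * A k)"
    using split unfolding last by (simp add: algebra_simps)
  ultimately show ?thesis by (simp add: fps_of_poly_const)
qed

lemma has_rational_sum_euler:
  fixes q \<zeta> x :: "'a::field_char_0"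
  assumes "1 + q \<noteq> 0" and "1 + q * \<zeta> \<noteq> 0"
  shows "has_rational_sum (\<lambda>m. (- (q * \<zeta>)) ^ m * (of_nat m + x) ^ n)
    (poly (wq_euler_poly q \<zeta> n) x / (1 + q))"
proof (induction n rule: less_induct)
  case (less n)
  define a where "a = q * \<zeta>"
  define A where "A = (\<lambda>n. Abs_fps (\<lambda>m. (- a) ^ m * (of_nat m + x) ^ n))"
  define s where "s = (\<lambda>n. poly (wq_euler_poly q \<zeta> n) x / (1 + q))"
  have IH: "has_rational_sum (fps_nth (A k)) (s k)" if "k < n" for k
    using less[OF that] by (simp add: A_def s_def a_def fps_nth_Abs_fps[abs_def])
  have "has_rational_sum (fps_nth (fps_of_poly [:1, a:] * A n))
     (poly [:x ^ n:] 1 + (\<Sum>k<n. poly [:0, - a * of_nat (n choose k):] 1 * s k))"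
    unfolding A_def power_series_shift_expansion
    by (intro has_rational_sum_add has_rational_sum_of_poly has_rational_sum_sum
        has_rational_sum_mult_poly IH[unfolded A_def]) auto
  moreover have "poly [:x ^ n:] 1 + (\<Sum>k<n. poly [:0, - a * of_nat (n choose k):] 1 * s k)
      = poly [:1, a:] 1 * s n"
  proof -
    have "a * (\<Sum>k\<le>n. of_nat (n choose k) * s k) + s n
        = (a * (\<Sum>k\<le>n. of_nat (n choose k) * poly (wq_euler_poly q \<zeta> k) x)
          + poly (wq_euler_poly q \<zeta> n) x) / (1 + q)"
      by (simp add: s_def add_divide_distrib flip: sum_divide_distrib)
    also have "\<dots> = x ^ n"
      unfolding a_def wq_euler_poly_sum_binomial[OF assms(2)] using assms(1) by simp
    finally show ?thesis
      by (simp add: sum_distrib_left sum_negf algebra_simps flip: lessThan_Suc_atMost)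
  qed
  ultimately have "has_rational_sum (fps_nth (A n)) (s n)"
    using assms(2) has_rational_sum_divide_poly[of "[:1, a:]" "A n" "s n"] by (simp add: a_def)
  then show ?case by (simp add: A_def s_def a_def fps_nth_Abs_fps[abs_def])
qed

lemma wq_zeta_nonpos:
  fixes q \<zeta> x :: "'a::field_char_0"
  assumes "1 + q \<noteq> 0" and "1 + q * \<zeta> \<noteq> 0"
  shows "wq_zeta q \<zeta> (- int n) x = poly (wq_euler_poly q \<zeta> n) x"
proof -
  have "(\<lambda>m. (-1) ^ m * q ^ m * \<zeta> ^ m / (of_nat m + x) powi (- int n))
      = (\<lambda>m. (- (q * \<zeta>)) ^ m * (of_nat m + x) ^ n)"
    by (rule ext) (simp add: power_int_minus divide_inverse power_mult_distrib
        power_minus[of "q * \<zeta>"])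
  then show ?thesis
    using rational_sum_eq[OF has_rational_sum_euler[OF assms]] assms(1)
    by (simp add: wq_zeta_def qbracket2_def)
qed

context padic_complex_field
begin

lemma nrm_one: "nrm 1 = 1"
  using nrm_mult[of 1 1] nrm_eq_0_iff[of 1] by simp

lemma nrm_neg: "nrm (- x) = nrm x"
proof -
  have "nrm (- 1) * nrm (- 1) = 1" using nrm_mult[of "- 1" "- 1"] nrm_one by simp
  then have "nrm (- 1) = 1"
    using nrm_nonneg[of "- 1"] by (metis abs_of_nonneg real_sqrt_abs2 real_sqrt_one)
  then show ?thesis using nrm_mult[of "- 1" x] by simp
qed

lemma nrm_of_nat_le: "nrm (of_nat n) \<le> 1"
proof (induction n)
  case 0
  then show ?case using nrm_eq_0_iff[of 0] by simp
next
  case (Suc n)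
  then show ?case using nrm_ultrametric[of 1 "of_nat n"] nrm_one by simp
qed

lemma nrm_two:
  assumes "odd p"
  shows "nrm 2 = 1"
proof (rule ccontr)
  assume "nrm 2 \<noteq> 1"
  then have 2: "nrm 2 < 1" using nrm_of_nat_le[of 2] by simp
  obtain k where k: "p = 2 * k + 1" using assms by (rule oddE)
  have "nrm (2 * of_nat k) < 1"
    using mult_mono[of "nrm 2" "nrm 2" "nrm (of_nat k)" 1] 2 nrm_of_nat_le[of k] nrm_nonneg nrm_mult[of 2 "of_nat k"]
    by simp
  moreover have "nrm (of_nat p) < 1"
    using nrm_p prime_gt_1_nat[OF prime_p] by simp
  moreover have "1 = of_nat p + - (2 * of_nat k :: 'a)" by (simp add: k)
  ultimately show False
    using nrm_ultrametric[of "of_nat p" "- (2 * of_nat k)"] nrm_one by (simp add: nrm_neg)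
qed

lemma one_plus_nonzero:
  assumes "odd p" and "nrm (u - 1) < 1"
  shows "1 + u \<noteq> 0"
proof
  assume "1 + u = 0"
  then have "u - 1 = - 2" by (simp add: add_eq_0_iff)
  then have "nrm (u - 1) = 1" using nrm_two[OF assms(1)] nrm_neg[of 2] by (simp only:)
  then show False using assms(2) by simp
qed

lemma nrm_mult_minus_one:
  assumes "nrm (u - 1) < 1" and "nrm (v - 1) < 1"
  shows "nrm (u * v - 1) < 1"
proof -
  have "nrm v \<le> 1" using nrm_ultrametric[of 1 "v - 1"] nrm_one assms(2) by simp
  then have "nrm ((u - 1) * v) < 1"
    using mult_left_le[of "nrm v" "nrm (u - 1)"] nrm_nonneg assms(1) nrm_mult[of "u - 1" v] by simp
  then show ?thesis
    using nrm_ultrametric[of "(u - 1) * v" "v - 1"] assms(2) by (simp add: algebra_simps)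
qed

end

theorem theorem1:
  fixes p :: nat and nrm :: "'a :: {field_char_0, alg_closed_field} \<Rightarrow> real" and q \<zeta> :: 'a
  assumes "padic_complex_field p nrm"
    and "odd p"
    and "nrm (q - 1) < 1"
    and "nrm (1 - \<zeta>) < 1"
  shows "(\<forall>n. wq_euler_poly q \<zeta> (Suc n) = recurrence_op q \<zeta> (wq_euler_poly q \<zeta> n)) \<and>
    (\<forall>n. \<exists>L. (\<forall>x. wq_zeta q \<zeta> (- int n) x = poly L x) \<and>
             (\<forall>x. wq_zeta q \<zeta> (- int n - 1) x = poly (recurrence_op q \<zeta> L) x))"
proof -
  interpret padic_complex_field p nrm by fact
  have "nrm (\<zeta> - 1) < 1" using assms(4) nrm_neg[of "1 - \<zeta>"] by simp
  then have nz: "1 + q \<noteq> 0" "1 + q * \<zeta> \<noteq> 0"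
    using assms(2,3) one_plus_nonzero nrm_mult_minus_one by blast+
  have "- int n - 1 = - int (Suc n)" for n by simp
  then show ?thesis
    using wq_euler_poly_Suc[OF nz] wq_zeta_nonpos[OF nz] by metis
qed

end
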